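(* Let $A\neq B$ be points of $\mathbb{R}^3$, let $X$ be uniformly distributed on the line segment $\overline{AB}$, let $P\in\mathbb{R}^3$, and set $D=\|\overrightarrow{PX}\|_2$. Let $$P_0=A+\frac{\langle\overrightarrow{AB},\overrightarrow{AP}\rangle}{\|\overrightarrow{AB}\|_2^2}\,\overrightarrow{AB}$$ be the orthogonal projection of $P$ onto the line through $A$ and $B$, and let $d_{\min}=\min(\|\overrightarrow{PA}\|_2,\|\overrightarrow{PB}\|_2)$, $d_{\max}=\max(\|\overrightarrow{PA}\|_2,\|\overrightarrow{PB}\|_2)$. Then the cumulative distribution function $F_D$ of $D$ is as follows. (1) If $\langle\overrightarrow{P_0A},\overrightarrow{P_0B}\rangle\le 0$ (equivalently, $P_0\in\overline{AB}$): $$F_D(d)=\begin{cases}0 & \text{if } d<\|\overrightarrow{PP_0}\|_2,\\[2pt] \dfrac{2\sqrt{d^2-\|\overrightarrow{PP_0}\|_2^2}}{\|\overrightarrow{AB}\|_2} & \text{if } \|\overrightarrow{PP_0}\|_2\le d\le d_{\min},\\[6pt] \dfrac{\min(\|\overrightarrow{P_0A}\|_2,\|\overrightarrow{P_0B}\|_2)+\sqrt{d^2-\|\overrightarrow{PP_0}\|_2^2}}{\|\overrightarrow{AB}\|_2} & \text{if } d_{\min}\le d\le d_{\max},\\[6pt] 1 & \text{if } d>d_{\max}.\end{cases}$$ (2) If $\langle\overrightarrow{P_0A},\overrightarrow{P_0B}\rangle>0$ (equivalently, $P_0\notin\overline{AB}$): $$F_D(d)=\begin{cases}0 & \text{if }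 d<d_{\min},\\[2pt] \dfrac{\sqrt{d^2-\|\overrightarrow{PP_0}\|_2^2}-\sqrt{d_{\min}^2-\|\overrightarrow{PP_0}\|_2^2}}{\|\overrightarrow{AB}\|_2} & \text{if } d_{\min}\le d\le d_{\max},\\[6pt] 1 & \text{if } d>d_{\max}.\end{cases}$$
   Context: $\overline{AB}=\{tA+(1-t)B : t\in[0,1]\}$. "Uniformly distributed on $\overline{AB}$" means with respect to normalized length (one-dimensional Lebesgue) measure on the segment. $F_D(d)=\mathbb{P}(D\le d)$. $\langle\cdot,\cdot\rangle$ is the usual scalar product and $\|\cdot\|_2$ the Euclidean norm on $\mathbb{R}^3$. *)

theory Defs
  imports "HOL-Probability.Probability"
begin

text \<open>One-dimensional Lebesgue measure on the line through \<open>A \<noteq> B\<close>, as a Borel measure on the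
  ambient space: the image of \<^const>\<open>lborel\<close> under the arc-length parametrisation. (Only
  meaningful for \<open>A \<noteq> B\<close>, where \<open>sgn (B - A)\<close> is the unit vector from \<open>A\<close> towards \<open>B\<close>.)\<close>

definition line_length_measure :: "real^3 \<Rightarrow> real^3 \<Rightarrow> (real^3) measure" where
  "line_length_measure A B = distr lborel borel (\<lambda>s. A + s *\<^sub>R sgn (B - A))"

definition uniformly_distributed_on_segment ::
    "'w measure \<Rightarrow> ('w \<Rightarrow> real^3) \<Rightarrow> real^3 \<Rightarrow> real^3 \<Rightarrow> bool" where
  "uniformly_distributed_on_segment M X A B \<longleftrightarrow>
     X \<in> borel_measurable M \<and>
     distr M borel X = uniform_measure (line_length_measure A B) (closed_segment A B)"

end

theory Submission
  imports Defs
begin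

text \<open>Parametrise the line through \<open>A\<close> and \<open>B\<close> by arc length, \<open>s \<mapsto> A + s u\<close> with \<open>u = sgn (B - A)\<close>,
  so that the segment is the parameter interval \<open>[0, L]\<close> with \<open>L = \<parallel>B - A\<parallel>\<close> and the foot \<open>P0\<close> of
  the perpendicular has parameter \<open>p = \<langle>P - A, u\<rangle>\<close>. By Pythagoras the point with parameter \<open>s\<close> has
  squared distance \<open>(s - p)\<^sup>2 + h\<^sup>2\<close> from \<open>P\<close>, where \<open>h = \<parallel>P0 - P\<parallel>\<close>. Hence the event \<open>D \<le> d\<close> is
  empty for \<open>d < h\<close>; for \<open>d \<ge> h\<close> it says that the parameter, which is uniform on \<open>[0, L]\<close>, lies in
  \<open>[p - r, p + r]\<close> with \<open>r = \<surd>(d\<^sup>2 - h\<^sup>2)\<close>. So \<open>F d\<close> is the length of \<open>[0, L] \<inter> [p - r, p + r]\<close>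
  divided by \<open>L\<close> (lemma \<open>cdf_dist_uniform_segment\<close>).

  All cases of the theorem read this overlap off for the possible positions of \<open>p\<close> relative to
  \<open>[0, L]\<close>. The substitution \<open>d \<mapsto> r\<close> turns the thresholds \<open>dmin\<close>, \<open>dmax\<close> into the smaller and the
  larger of \<open>\<bar>p\<bar> = \<parallel>A - P0\<parallel>\<close> and \<open>\<bar>L - p\<bar> = \<parallel>B - P0\<parallel>\<close> (lemmas \<open>hypotenuse_le_iff\<close> and
  \<open>le_hypotenuse_iff\<close>), so what remains is piecewise linear arithmetic in \<open>p\<close>, \<open>r\<close> and \<open>L\<close>.\<close>

section \<open>Arc-length geometry of a segment\<close>

lemma arc_length_in_segment_iff:
  fixes A B :: "'a::real_normed_vector"
  assumes "A \<noteq> B"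
  shows "A + s *\<^sub>R sgn (B - A) \<in> closed_segment A B \<longleftrightarrow> 0 \<le> s \<and> s \<le> norm (B - A)"
proof -
  have L: "norm (B - A) > 0" using assms by simp
  have "A + s *\<^sub>R sgn (B - A) \<in> closed_segment A B \<longleftrightarrow>
      (\<exists>t. 0 \<le> t \<and> t \<le> 1 \<and> s *\<^sub>R sgn (B - A) = t *\<^sub>R (B - A))"
    unfolding closed_segment_def by (auto simp: algebra_simps)
  also have "\<dots> \<longleftrightarrow> (\<exists>t. 0 \<le> t \<and> t \<le> 1 \<and> s / norm (B - A) = t)"
    using assms by (simp add: sgn_div_norm divide_inverse)
  also have "\<dots> \<longleftrightarrow> 0 \<le> s / norm (B - A) \<and> s / norm (B - A) \<le> 1"
    by blast
  also have "\<dots> \<longleftrightarrow> 0 \<le> s \<and> s \<le> norm (B - A)"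
    using L by (simp add: pos_divide_le_eq pos_le_divide_eq)
  finally show ?thesis .
qed

text \<open>Pythagoras for the right triangle formed by \<open>P\<close>, its projection and a point of the line.\<close>

lemma norm_arc_length_diff:
  fixes A P u :: "'a::real_inner"
  assumes "norm u = 1"
  defines "p \<equiv> (P - A) \<bullet> u"
  shows "norm (A + s *\<^sub>R u - P) = sqrt ((s - p)\<^sup>2 + (norm (A + p *\<^sub>R u - P))\<^sup>2)"
proof -
  have u: "u \<bullet> u = 1" using assms by (simp add: dot_square_norm)
  have split: "A + s *\<^sub>R u - P = (s - p) *\<^sub>R u + (A + p *\<^sub>R u - P)"
    by (simp add: algebra_simps)
  have "orthogonal ((s - p) *\<^sub>R u) (A + p *\<^sub>R u - P)"
    unfolding orthogonal_def p_def by (simp add: inner_simps u inner_commute)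
  then have "(norm (A + s *\<^sub>R u - P))\<^sup>2 = (norm ((s - p) *\<^sub>R u))\<^sup>2 + (norm (A + p *\<^sub>R u - P))\<^sup>2"
    unfolding split by (rule norm_add_Pythagorean)
  also have "(norm ((s - p) *\<^sub>R u))\<^sup>2 = (s - p)\<^sup>2"
    using assms(1) by simp
  finally have "(norm (A + s *\<^sub>R u - P))\<^sup>2 = (s - p)\<^sup>2 + (norm (A + p *\<^sub>R u - P))\<^sup>2" .
  then show ?thesis by (metis norm_ge_zero real_sqrt_unique)
qed

text \<open>The next two lemmas trade conditions on the distance \<open>d\<close> from \<open>P\<close> for conditions on the
  half-width \<open>\<surd>(d\<^sup>2 - h\<^sup>2)\<close> of the parameter window: the former gives the event \<open>D \<le> d\<close>, and
  both together locate \<open>d\<close> relative to the distances of \<open>A\<close> and \<open>B\<close> from \<open>P\<close>.\<close>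

lemma hypotenuse_le_iff:
  fixes q h d :: real
  assumes "0 \<le> h" "h \<le> d"
  shows "sqrt (q\<^sup>2 + h\<^sup>2) \<le> d \<longleftrightarrow> \<bar>q\<bar> \<le> sqrt (d\<^sup>2 - h\<^sup>2)"
proof -
  have "sqrt (q\<^sup>2 + h\<^sup>2) \<le> d \<longleftrightarrow> q\<^sup>2 + h\<^sup>2 \<le> d\<^sup>2"
    using assms real_sqrt_le_iff[of "q\<^sup>2 + h\<^sup>2" "d\<^sup>2"] by simp
  also have "\<dots> \<longleftrightarrow> q\<^sup>2 \<le> d\<^sup>2 - h\<^sup>2" by auto
  also have "\<dots> \<longleftrightarrow> \<bar>q\<bar> \<le> sqrt (d\<^sup>2 - h\<^sup>2)"
    using real_sqrt_le_iff[of "q\<^sup>2" "d\<^sup>2 - h\<^sup>2"] by simp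
  finally show ?thesis .
qed

lemma le_hypotenuse_iff:
  fixes q h d :: real
  assumes "0 \<le> h" "h \<le> d"
  shows "d \<le> sqrt (q\<^sup>2 + h\<^sup>2) \<longleftrightarrow> sqrt (d\<^sup>2 - h\<^sup>2) \<le> \<bar>q\<bar>"
proof -
  have "d \<le> sqrt (q\<^sup>2 + h\<^sup>2) \<longleftrightarrow> d\<^sup>2 \<le> q\<^sup>2 + h\<^sup>2"
    using assms real_sqrt_le_iff[of "d\<^sup>2" "q\<^sup>2 + h\<^sup>2"] by simp
  also have "\<dots> \<longleftrightarrow> d\<^sup>2 - h\<^sup>2 \<le> q\<^sup>2" by auto
  also have "\<dots> \<longleftrightarrow> sqrt (d\<^sup>2 - h\<^sup>2) \<le> \<bar>q\<bar>"
    using real_sqrt_le_iff[of "d\<^sup>2 - h\<^sup>2" "q\<^sup>2"] by simp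
  finally show ?thesis .
qed

section \<open>The distribution function as an overlap of intervals\<close>

lemma emeasure_line_length_measure:
  assumes "S \<in> sets borel"
  shows "emeasure (line_length_measure A B) S = emeasure lborel {s. A + s *\<^sub>R sgn (B - A) \<in> S}"
  using assms unfolding line_length_measure_def
  by (subst emeasure_distr) (auto simp: vimage_def)

lemma prob_uniform_segment:
  assumes "A \<noteq> B" "uniformly_distributed_on_segment M X A B"
    and S: "S \<in> sets borel"
  shows "measure (distr M borel X) S =
    measure lborel {s. s \<in> {0..norm (B - A)} \<and> A + s *\<^sub>R sgn (B - A) \<in> S} / norm (B - A)"
proof -
  let ?L = "norm (B - A)" and ?\<mu> = "line_length_measure A B"
  let ?g = "\<lambda>s. A + s *\<^sub>R sgn (B - A)"
  have L: "?L > 0" using assms by simp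
  have sets: "sets ?\<mu> = sets borel" by (simp add: line_length_measure_def)
  have seg: "{s. ?g s \<in> closed_segment A B} = {0..?L}"
    unfolding arc_length_in_segment_iff[OF assms(1)] by auto
  have "emeasure ?\<mu> (closed_segment A B) = ennreal ?L"
    using L by (subst emeasure_line_length_measure) (simp_all add: seg)
  moreover have "emeasure ?\<mu> (closed_segment A B \<inter> S) =
      emeasure lborel {s. s \<in> {0..?L} \<and> ?g s \<in> S}"
  proof -
    have "{s. ?g s \<in> closed_segment A B \<inter> S} = {s. s \<in> {0..?L} \<and> ?g s \<in> S}"
      using seg by blast
    moreover have "closed_segment A B \<inter> S \<in> sets borel"
      using S by simp
    ultimately show ?thesis by (simp only: emeasure_line_length_measure)
  qed
  moreover have "distr M borel X = uniform_measure ?\<mu> (closed_segment A B)"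
    using assms(2) by (simp add: uniformly_distributed_on_segment_def)
  ultimately have "emeasure (distr M borel X) S =
      emeasure lborel {s. s \<in> {0..?L} \<and> ?g s \<in> S} / ennreal ?L"
    using S sets by (simp only: emeasure_uniform_measure borel_closed closed_segment)
  then show ?thesis
    using L by (simp only: measure_def divide_ennreal_def inverse_ennreal enn2real_mult
        divide_inverse enn2real_ennreal inverse_nonnegative_iff_nonnegative less_imp_le)
qed

text \<open>The truncation by \<open>0\<close> covers the values \<open>d\<close> for which \<open>[0, L]\<close> and \<open>[p - r, p + r]\<close> are
  disjoint.\<close>

lemma cdf_dist_uniform_segment:
  fixes A B P :: "real^3" and d :: real
  assumes "A \<noteq> B" "uniformly_distributed_on_segment M X A B"
  defines "u \<equiv> sgn (B - A)"
  defines "p \<equiv> (P - A) \<bullet> u"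
  defines "h \<equiv> norm (A + p *\<^sub>R u - P)"
  defines "r \<equiv> sqrt (d\<^sup>2 - h\<^sup>2)"
  shows "cdf (distr M borel (\<lambda>\<omega>. norm (X \<omega> - P))) d =
    (if d < h then 0 else max 0 (min (norm (B - A)) (p + r) - max 0 (p - r)) / norm (B - A))"
proof -
  let ?L = "norm (B - A)"
  have L: "?L > 0" using assms(1) by simp
  have u: "norm u = 1" using assms(1) by (simp add: u_def norm_sgn)
  have dist: "norm (A + s *\<^sub>R u - P) = sqrt ((s - p)\<^sup>2 + h\<^sup>2)" for s
    using norm_arc_length_diff[OF u, of A s P] by (simp only: p_def h_def)
  have X: "X \<in> borel_measurable M"
    using assms(2) by (simp add: uniformly_distributed_on_segment_def)
  have "distr M borel (\<lambda>\<omega>. norm (X \<omega> - P)) = distr (distr M borel X) borel (\<lambda>x. norm (x - P))"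
    using X by (subst distr_distr) (auto simp: o_def)
  then have "cdf (distr M borel (\<lambda>\<omega>. norm (X \<omega> - P))) d =
      measure (distr M borel X) {x. norm (x - P) \<le> d}"
    unfolding cdf_def by (simp add: measure_distr vimage_def)
  also have "\<dots> = measure lborel {s. s \<in> {0..?L} \<and> norm (A + s *\<^sub>R u - P) \<le> d} / ?L"
    using prob_uniform_segment[OF assms(1,2), of "{x. norm (x - P) \<le> d}"] by (simp add: u_def)
  also have "\<dots> = (if d < h then 0 else max 0 (min ?L (p + r) - max 0 (p - r)) / ?L)"
  proof (cases "d < h")
    case True
    have "h \<le> norm (A + s *\<^sub>R u - P)" for s
      unfolding dist by (rule real_le_rsqrt) simp
    with True have empty: "{s. s \<in> {0..?L} \<and> norm (A + s *\<^sub>R u - P) \<le> d} = {}"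
      by (auto simp: not_le intro: less_le_trans)
    show ?thesis unfolding empty using True by simp
  next
    case False
    have near: "norm (A + s *\<^sub>R u - P) \<le> d \<longleftrightarrow> \<bar>s - p\<bar> \<le> r" for s
      unfolding dist r_def
      using False by (intro hypotenuse_le_iff) (auto simp: h_def)
    have overlap: "{s. s \<in> {0..?L} \<and> norm (A + s *\<^sub>R u - P) \<le> d} = {max 0 (p - r)..min ?L (p + r)}"
      unfolding near by auto
    have "measure lborel {a..b} = max 0 (b - a)" for a b :: real
      by simp
    then show ?thesis
      unfolding overlap using False by (simp only: if_False)
  qed
  finally show ?thesis .
qed

section \<open>The case distinction\<close>

theorem mainTheorem3:
  fixes A B P P0 :: "real^3"
    and M :: "'w measure"
    and X :: "'w \<Rightarrow> real^3"
    and D :: "'w \<Rightarrow> real"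
    and F :: "real \<Rightarrow> real"
    and dmin dmax :: real
  assumes "A \<noteq> B"
    and "prob_space M"
    and "uniformly_distributed_on_segment M X A B"
    and "D = (\<lambda>\<omega>. norm (X \<omega> - P))"
    and "F = cdf (distr M borel D)"
    and "P0 = A + (((B - A) \<bullet> (P - A)) / (norm (B - A))\<^sup>2) *\<^sub>R (B - A)"
    and "dmin = min (norm (A - P)) (norm (B - P))"
    and "dmax = max (norm (A - P)) (norm (B - P))"
  shows "P0 \<in> affine hull {A, B} \<and> orthogonal (P - P0) (B - A) \<and>
    ((A - P0) \<bullet> (B - P0) \<le> 0 \<longleftrightarrow> P0 \<in> closed_segment A B) \<and>
    ((A - P0) \<bullet> (B - P0) \<le> 0 \<longrightarrow>
      (\<forall>d.
        (d < norm (P0 - P) \<longrightarrow> F d = 0) \<and>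
        (norm (P0 - P) \<le> d \<and> d \<le> dmin \<longrightarrow>
          F d = 2 * sqrt (d\<^sup>2 - (norm (P0 - P))\<^sup>2) / norm (B - A)) \<and>
        (dmin \<le> d \<and> d \<le> dmax \<longrightarrow>
          F d = (min (norm (A - P0)) (norm (B - P0)) + sqrt (d\<^sup>2 - (norm (P0 - P))\<^sup>2))
                  / norm (B - A)) \<and>
        (d > dmax \<longrightarrow> F d = 1))) \<and>
    ((A - P0) \<bullet> (B - P0) > 0 \<longleftrightarrow> P0 \<notin> closed_segment A B) \<and>
    ((A - P0) \<bullet> (B - P0) > 0 \<longrightarrow>
      (\<forall>d.
        (d < dmin \<longrightarrow> F d = 0) \<and>
        (dmin \<le> d \<and> d \<le> dmax \<longrightarrow>
          F d = (sqrt (d\<^sup>2 - (norm (P0 - P))\<^sup>2) - sqrt (dmin\<^sup>2 - (norm (P0 - P))\<^sup>2))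
                  / norm (B - A)) \<and>
        (d > dmax \<longrightarrow> F d = 1)))"
proof -
  define L u p h where "L = norm (B - A)" and "u = sgn (B - A)"
    and "p = (P - A) \<bullet> u" and "h = norm (P0 - P)"
  define r where "r d = sqrt (d\<^sup>2 - h\<^sup>2)" for d
  have L: "L > 0" using assms(1) by (simp add: L_def)
  have h: "h \<ge> 0" by (simp add: h_def)
  have u: "norm u = 1" using assms(1) by (simp add: u_def norm_sgn)
  have BA: "B - A = L *\<^sub>R u" using L by (simp add: u_def L_def sgn_div_norm)
  have P0: "P0 = A + p *\<^sub>R u"
    using L u unfolding assms(6) L_def[symmetric] BA p_def
    by (simp add: power2_eq_square inner_commute)
  have nA: "norm (A - P) = sqrt (p\<^sup>2 + h\<^sup>2)"
    using norm_arc_length_diff[OF u, of A 0 P] by (simp add: P0 p_def h_def)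
  have "B = A + L *\<^sub>R u" using BA by (simp add: algebra_simps)
  then have nB: "norm (B - P) = sqrt ((L - p)\<^sup>2 + h\<^sup>2)"
    using norm_arc_length_diff[OF u, of A L P] by (simp add: P0 p_def h_def)
  have AP0: "A - P0 = (- p) *\<^sub>R u" by (simp add: P0)
  have BP0: "B - P0 = (L - p) *\<^sub>R u" using BA by (simp add: P0 algebra_simps)
  have nA0: "norm (A - P0) = \<bar>p\<bar>" and nB0: "norm (B - P0) = \<bar>L - p\<bar>"
    using u by (simp_all add: AP0 BP0)
  have "(A - P0) \<bullet> (B - P0) = - p * (L - p)"
    using u by (simp add: AP0 BP0 dot_square_norm)
  then have inner: "(A - P0) \<bullet> (B - P0) \<le> 0 \<longleftrightarrow> 0 \<le> p \<and> p \<le> L"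
    using L by (auto simp: mult_le_0_iff zero_le_mult_iff)
  have seg: "P0 \<in> closed_segment A B \<longleftrightarrow> 0 \<le> p \<and> p \<le> L"
    using arc_length_in_segment_iff[OF assms(1), of p] by (simp add: P0 u_def L_def)
  have line: "P0 \<in> affine hull {A, B}"
    unfolding affine_hull_2_alt assms(6) by blast
  have orth: "orthogonal (P - P0) (B - A)"
    using u unfolding orthogonal_def BA P0 p_def by (simp add: inner_simps dot_square_norm)

  have F: "F d = (if d < h then 0 else max 0 (min L (p + r d) - max 0 (p - r d)) / L)" for d
    using cdf_dist_uniform_segment[OF assms(1,3), of P d]
    by (simp add: assms(4,5) L_def r_def h_def P0 p_def u_def)
  have r0: "r d \<ge> 0" if "h \<le> d" for d
    using that h by (simp add: r_def power_mono)
  have hmin: "h \<le> dmin"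
    unfolding assms(7) nA nB by (auto intro!: real_le_rsqrt)
  have minmax: "dmin \<le> dmax" by (simp add: assms(7,8))
  have le_min: "d \<le> dmin \<longleftrightarrow> r d \<le> min \<bar>p\<bar> \<bar>L - p\<bar>"
    and le_max: "d \<le> dmax \<longleftrightarrow> r d \<le> max \<bar>p\<bar> \<bar>L - p\<bar>"
    and min_le: "dmin \<le> d \<longleftrightarrow> min \<bar>p\<bar> \<bar>L - p\<bar> \<le> r d" if "h \<le> d" for d
    using le_hypotenuse_iff[OF h that] hypotenuse_le_iff[OF h that]
    unfolding assms(7,8) nA nB r_def by (auto simp: min_le_iff_disj le_max_iff_disj)
  have r_min: "r dmin = min \<bar>p\<bar> \<bar>L - p\<bar>"
    using le_min[OF hmin] min_le[OF hmin] by linarith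

  have below: "F d = 0" if "d < h" for d
    using that by (simp add: F)
  have beyond: "F d = 1" if "d > dmax" for d
  proof -
    have d: "h \<le> d" using that hmin minmax by linarith
    then have "r d > max \<bar>p\<bar> \<bar>L - p\<bar>" using le_max that by force
    then have "max 0 (min L (p + r d) - max 0 (p - r d)) = L" using L by linarith
    then show ?thesis using F[of d] d L by simp
  qed
  have both_sides: "F d = 2 * r d / L" if "0 \<le> p" "p \<le> L" "h \<le> d" "d \<le> dmin" for d
  proof -
    have "r d \<le> min \<bar>p\<bar> \<bar>L - p\<bar>" using le_min that by blast
    then have "max 0 (min L (p + r d) - max 0 (p - r d)) = 2 * r d"
      using that(1,2) r0[OF that(3)] by linarith
    then show ?thesis using F[of d] that(3) by simp
  qed
  have one_side: "F d = (min \<bar>p\<bar> \<bar>L - p\<bar> + r d) / L"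
    if "0 \<le> p" "p \<le> L" "dmin \<le> d" "d \<le> dmax" for d
  proof -
    have d: "h \<le> d" using that hmin by linarith
    have "min \<bar>p\<bar> \<bar>L - p\<bar> \<le> r d" "r d \<le> max \<bar>p\<bar> \<bar>L - p\<bar>"
      using le_max[OF d] min_le[OF d] that by blast+
    then have "max 0 (min L (p + r d) - max 0 (p - r d)) = min \<bar>p\<bar> \<bar>L - p\<bar> + r d"
      using that(1,2) r0[OF d] by linarith
    then show ?thesis using F[of d] d by simp
  qed
  have outside_below: "F d = 0" if "\<not> (0 \<le> p \<and> p \<le> L)" "d < dmin" for d
  proof (cases "d < h")
    case False
    then have "r d < min \<bar>p\<bar> \<bar>L - p\<bar>" using min_le[of d] that(2) by linarith
    then have "max 0 (min L (p + r d) - max 0 (p - r d)) = 0"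
      using that(1) L by linarith
    then show ?thesis using F[of d] by simp
  qed (rule below)
  have outside_between: "F d = (r d - r dmin) / L"
    if "\<not> (0 \<le> p \<and> p \<le> L)" "dmin \<le> d" "d \<le> dmax" for d
  proof -
    have d: "h \<le> d" using that hmin by linarith
    have "min \<bar>p\<bar> \<bar>L - p\<bar> \<le> r d" "r d \<le> max \<bar>p\<bar> \<bar>L - p\<bar>"
      using le_max[OF d] min_le[OF d] that by blast+
    then have "max 0 (min L (p + r d) - max 0 (p - r d)) = r d - min \<bar>p\<bar> \<bar>L - p\<bar>"
      using that(1) L r0[OF d] by linarith
    then show ?thesis using F[of d] d by (simp add: r_min)
  qed

  have pos: "(A - P0) \<bullet> (B - P0) > 0 \<longleftrightarrow> \<not> (0 \<le> p \<and> p \<le> L)"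
    unfolding inner[symmetric] by linarith
  show ?thesis
    unfolding inner pos seg nA0 nB0 h_def[symmetric] L_def[symmetric] r_def[symmetric]
    using line orth below beyond both_sides one_side outside_below outside_between
    by blast
qed

end
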